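(* Let $(X,p)$ be a partial metric space and let $a$ be a real constant such that $p(x,x)=a$ for all $x\in X$. Let $\{x_n\}$ be a sequence in $X$. If $c\in X$ is a cluster point of $\{x_n\}$, then $LIM^{r}x_n\subset\overline{B^{p}_{r}}(c)$ for some $r>0$.
   Context: A partial metric on a nonempty set $X$ is a function $p:X\times X\to[0,\infty)$ such that for all $x,y,z\in X$: (p1) $0\le p(x,x)\le p(x,y)$; (p2) $x=y \iff p(x,x)=p(x,y)=p(y,y)$; (p3) $p(x,y)=p(y,x)$; (p4) $p(x,y)\le p(x,z)+p(z,y)-p(z,z)$. The pair $(X,p)$ is a partial metric space. A point $c\in X$ is a cluster point of $\{x_n\}$ if for every $\epsilon>0$ and every $k\in\mathbb{N}$ there is $k_1\in\mathbb{N}$ with $k_1>k$ and $|p(x_{k_1},c)-p(c,c)|<\epsilon$. For $r>0$ and $x\in X$, the closed ball is $\overline{B^{p}_{r}}(x)=\{y\in X:p(x,y)\le p(x,x)+r\}$. For a real number $r\ge 0$, $\{x_n\}$ is $r$-convergent to $x\in X$ if for every $\epsilon>0$ there is $k\in\mathbb{N}$ such that $|p(x_n,x)-p(x,x)|<r+\epsilon$ for all $n\ge k$. $LIM^{r}x_n$ is the set of all $x\in X$ such that $\{x_n\}$ is $r$-convergent to $x$. The symbol $\subset$ denotes (not necessarily strict) inclusion. *)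

theory Defs
  imports Complex_Main
begin

text \<open>
  The codomain $[0,\infty)$ of a partial metric is rendered as \<^typ>\<open>real\<close> with
  nonnegativity following from \<open>self_nonneg\<close> and \<open>self_le\<close>.  All axioms are relative to the carrier \<open>X\<close>;
  the values of \<open>p\<close> outside \<open>X\<close> are irrelevant.
\<close>

locale partial_metric_space =
  fixes X :: "'a set" and p :: "'a \<Rightarrow> 'a \<Rightarrow> real"
  assumes nonempty: "X \<noteq> {}"
    and self_nonneg: "x \<in> X \<Longrightarrow> 0 \<le> p x x"
    and self_le: "\<lbrakk>x \<in> X; y \<in> X\<rbrakk> \<Longrightarrow> p x x \<le> p x y"
    and eq_iff: "\<lbrakk>x \<in> X; y \<in> X\<rbrakk> \<Longrightarrow> x = y \<longleftrightarrow> p x x = p x y \<and> p x y = p y y"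
    and sym: "\<lbrakk>x \<in> X; y \<in> X\<rbrakk> \<Longrightarrow> p x y = p y x"
    and triangle: "\<lbrakk>x \<in> X; y \<in> X; z \<in> X\<rbrakk> \<Longrightarrow> p x y \<le> p x z + p z y - p z z"

definition pm_cluster_point ::
    "'a set \<Rightarrow> ('a \<Rightarrow> 'a \<Rightarrow> real) \<Rightarrow> (nat \<Rightarrow> 'a) \<Rightarrow> 'a \<Rightarrow> bool" where
  "pm_cluster_point X p x c \<longleftrightarrow>
     c \<in> X \<and> (\<forall>\<epsilon>>0. \<forall>k. \<exists>k1>k. \<bar>p (x k1) c - p c c\<bar> < \<epsilon>)"

definition pm_cball :: "'a set \<Rightarrow> ('a \<Rightarrow> 'a \<Rightarrow> real) \<Rightarrow> real \<Rightarrow> 'a \<Rightarrow> 'a set" where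
  "pm_cball X p r x = {y \<in> X. p x y \<le> p x x + r}"

definition rough_convergent ::
    "('a \<Rightarrow> 'a \<Rightarrow> real) \<Rightarrow> real \<Rightarrow> (nat \<Rightarrow> 'a) \<Rightarrow> 'a \<Rightarrow> bool" where
  "rough_convergent p r x l \<longleftrightarrow>
     (\<forall>\<epsilon>>0. \<exists>k. \<forall>n\<ge>k. \<bar>p (x n) l - p l l\<bar> < r + \<epsilon>)"

definition rough_LIM ::
    "'a set \<Rightarrow> ('a \<Rightarrow> 'a \<Rightarrow> real) \<Rightarrow> real \<Rightarrow> (nat \<Rightarrow> 'a) \<Rightarrow> 'a set" where
  "rough_LIM X p r x = {l \<in> X. rough_convergent p r x l}"

end

theory Submission
  imports Defs
begin

text \<open>A rough limit \<open>l\<close> is eventually within about \<open>r\<close> of the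
  sequence, in excess over the self-distance, while the cluster point \<open>c\<close> is approached
  arbitrarily closely at arbitrarily late indices. The triangle inequality through one such term
  bounds \<open>p c l\<close>; since all self-distances equal \<open>a\<close>, the excesses simply
  add. This works for every real \<open>r\<close>, so the existential claim follows at once.\<close>

lemma (in partial_metric_space) rough_LIM_subset_cball_cluster_point:
  assumes const: "\<And>y. y \<in> X \<Longrightarrow> p y y = a"
    and x: "\<And>n. x n \<in> X"
    and cluster: "pm_cluster_point X p x c"
  shows "rough_LIM X p r x \<subseteq> pm_cball X p r c"
proof
  fix l assume "l \<in> rough_LIM X p r x"
  then have l: "l \<in> X" and conv: "rough_convergent p r x l"
    by (auto simp: rough_LIM_def)
  have c: "c \<in> X"
    using cluster by (simp add: pm_cluster_point_def)
  have "p c l \<le> p c c + r"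
  proof (rule field_le_epsilon)
    fix e :: real assume "e > 0"
    then have e: "e / 2 > 0" by simp
    obtain k where k: "\<And>n. n \<ge> k \<Longrightarrow> \<bar>p (x n) l - p l l\<bar> < r + e / 2"
      using conv e unfolding rough_convergent_def by blast
    \<comment> \<open>Taking \<open>m\<close> beyond \<open>k\<close> makes both estimates hold at
      the same term \<open>x m\<close>.\<close>
    obtain m where m: "m > k" "\<bar>p (x m) c - p c c\<bar> < e / 2"
      using cluster e unfolding pm_cluster_point_def by blast
    have "p c l \<le> p (x m) c + p (x m) l - p (x m) (x m)"
      using triangle[OF c l x[of m]] sym[OF c x[of m]] by simp
    \<comment> \<open>With all self-distances equal to \<open>a\<close>, the bound is
      \<open>(a + e/2) + (a + r + e/2) - a\<close>.\<close>
    also have "\<dots> \<le> p c c + r + e"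
      using k[of m] m const[OF c] const[OF l] const[OF x[of m]] by linarith
    finally show "p c l \<le> p c c + r + e" .
  qed
  with l show "l \<in> pm_cball X p r c"
    by (simp add: pm_cball_def)
qed

theorem theorem3p14:
  fixes X :: "'a set" and p :: "'a \<Rightarrow> 'a \<Rightarrow> real"
    and a :: real and x :: "nat \<Rightarrow> 'a" and c :: 'a
  assumes "partial_metric_space X p"
    and "\<And>y. y \<in> X \<Longrightarrow> p y y = a"
    and "\<And>n. x n \<in> X"
    and "pm_cluster_point X p x c"
  shows "\<exists>r>0. rough_LIM X p r x \<subseteq> pm_cball X p r c"
  \<comment> \<open>The witness is \<open>r = 1\<close>; any positive value would do.\<close>
  using partial_metric_space.rough_LIM_subset_cball_cluster_point[OF assms]
    zero_less_one by blast

end
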